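(* Let $\lambda\neq 0$ and consider the real analytic system $\dot x=y+P(x,y,z)$, $\dot y=Q(x,y,z)$, $\dot z=-\lambda z+R(x,y,z)$, with $j^1P(0)=j^1Q(0)=j^1R(0)=0$. Then there exists a formal change of variables that transforms it into the formal normal form $$\dot x=y+xP_1(x),\qquad \dot y=Q_2(x)+yP_1(x),\qquad \dot z=-\lambda z+zR_1(x),$$ where $P_1,Q_2,R_1$ are formal power series in $x$ with $P_1(0)=j^1Q_2(0)=R_1(0)=0$.
   Context: $j^1G(0)$ denotes the Taylor polynomial of degree $1$ of $G$ at the origin. A formal change of variables is an invertible formal power series map of $\mathbb{R}^3$ fixing the origin. *)

theory Defs
  imports "HOL-Analysis.Analysis"
    "HOL-Computational_Algebra.Formal_Power_Series"
begin

text \<open>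
  Formal power series in three variables are iterated univariate ones; the outermost
  layer carries the first variable.  Coefficients are addressed by multi-indices of
  type \<^typ>\<open>nat^3\<close>.
\<close>

type_synonym fps3 = "real fps fps fps"

definition fps3_nth :: "fps3 \<Rightarrow> nat^3 \<Rightarrow> real" where
  "fps3_nth F m = fps_nth (fps_nth (fps_nth F (m $ 1)) (m $ 2)) (m $ 3)"

definition Abs_fps3 :: "(nat^3 \<Rightarrow> real) \<Rightarrow> fps3" where
  "Abs_fps3 c = Abs_fps (\<lambda>i. Abs_fps (\<lambda>j. Abs_fps (\<lambda>k. c (vector [i, j, k]))))"

lemma fps3_nth_Abs_fps3 [simp]: "fps3_nth (Abs_fps3 c) m = c m"
proof -
  have "vector [m $ 1, m $ 2, m $ 3] = m"
    by (simp add: vec_eq_iff forall_3)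
  then show ?thesis
    by (simp add: fps3_nth_def Abs_fps3_def)
qed

lemma fps3_eq_iff: "F = G \<longleftrightarrow> (\<forall>m. fps3_nth F m = fps3_nth G m)"
proof
  assume *: "\<forall>m. fps3_nth F m = fps3_nth G m"
  show "F = G"
  proof (intro fps_ext)
    fix i j k
    show "fps_nth (fps_nth (fps_nth F i) j) k = fps_nth (fps_nth (fps_nth G i) j) k"
      using *[rule_format, of "vector [i, j, k]"] by (simp add: fps3_nth_def)
  qed
qed simp

definition mdegree :: "nat^3 \<Rightarrow> nat" where
  "mdegree m = (\<Sum>i\<in>UNIV. m $ i)"

lemma finite_mdegree_le [simp]: "finite {m. mdegree m \<le> n}"
proof (rule finite_subset)
  show "{m. mdegree m \<le> n} \<subseteq> (\<lambda>(i, j, k). vector [i, j, k]) ` ({..n} \<times> {..n} \<times> {..n})"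
  proof
    fix m :: "nat^3" assume "m \<in> {m. mdegree m \<le> n}"
    then have "(m $ 1, m $ 2, m $ 3) \<in> {..n} \<times> {..n} \<times> {..n}"
      by (simp add: mdegree_def sum_3)
    moreover have "m = (\<lambda>(i, j, k). vector [i, j, k]) (m $ 1, m $ 2, m $ 3)"
      by (simp add: vec_eq_iff forall_3)
    ultimately show "m \<in> (\<lambda>(i, j, k). vector [i, j, k]) ` ({..n} \<times> {..n} \<times> {..n})"
      by (rule rev_image_eqI)
  qed
qed auto

definition fps3_const :: "real \<Rightarrow> fps3" where
  "fps3_const c = fps_const (fps_const (fps_const c))"

definition fps3_var :: "3 \<Rightarrow> fps3" where
  "fps3_var i = Abs_fps3 (\<lambda>m. if m = axis i 1 then 1 else 0)"

text \<open>A univariate series, read as a series in the first variable.\<close>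

definition fps3_of_fps :: "real fps \<Rightarrow> fps3" where
  "fps3_of_fps A = Abs_fps3 (\<lambda>m. if m $ 2 = 0 \<and> m $ 3 = 0 then fps_nth A (m $ 1) else 0)"

definition fps3_pderiv :: "3 \<Rightarrow> fps3 \<Rightarrow> fps3" where
  "fps3_pderiv i F = Abs_fps3 (\<lambda>m. of_nat (m $ i + 1) * fps3_nth F (m + axis i 1))"

definition fps3_jet :: "nat \<Rightarrow> fps3 \<Rightarrow> fps3" where
  "fps3_jet n F = Abs_fps3 (\<lambda>m. if mdegree m \<le> n then fps3_nth F m else 0)"


subsection \<open>Real analytic functions and their Taylor series at the origin\<close>

definition partial_deriv :: "3 \<Rightarrow> (real^3 \<Rightarrow> real) \<Rightarrow> real^3 \<Rightarrow> real" where
  "partial_deriv i f v = deriv (\<lambda>t. f (v + t *\<^sub>R axis i 1)) 0"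

definition taylor_series :: "(real^3 \<Rightarrow> real) \<Rightarrow> fps3" where
  "taylor_series f = Abs_fps3 (\<lambda>m.
     ((partial_deriv 1 ^^ (m $ 1)) ((partial_deriv 2 ^^ (m $ 2)) ((partial_deriv 3 ^^ (m $ 3)) f))) 0
       / (\<Prod>i\<in>UNIV. fact (m $ i)))"

text \<open>
  No smoothness is assumed separately: a function that agrees near the origin with the sum
  of any power series is smooth there, so the partial derivatives above are genuine.
\<close>

definition real_analytic_at_0 :: "(real^3 \<Rightarrow> real) \<Rightarrow> bool" where
  "real_analytic_at_0 f \<longleftrightarrow>
     (\<forall>\<^sub>F v in nhds 0.
        ((\<lambda>m. fps3_nth (taylor_series f) m * (\<Prod>i\<in>UNIV. v $ i ^ (m $ i))) has_sum f v) UNIV)"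


subsection \<open>Formal maps and formal vector fields\<close>

definition formal_fixes_origin :: "fps3^3 \<Rightarrow> bool" where
  "formal_fixes_origin \<Phi> \<longleftrightarrow> (\<forall>i. fps3_nth (\<Phi> $ i) 0 = 0)"

text \<open>
  Substitution of \<open>\<Phi>\<close> into \<open>F\<close>, meaningful only if \<open>\<Phi>\<close> fixes the origin.  In that case the
  product of powers of the components of \<open>\<Phi>\<close> with exponents \<open>a\<close> contains no terms of degree
  below \<^term>\<open>mdegree a\<close>, which makes the sum finite.
\<close>

definition fps3_compose :: "fps3 \<Rightarrow> fps3^3 \<Rightarrow> fps3" where
  "fps3_compose F \<Phi> = Abs_fps3 (\<lambda>m.
     \<Sum>a | mdegree a \<le> mdegree m. fps3_nth F a * fps3_nth (\<Prod>i\<in>UNIV. (\<Phi> $ i) ^ (a $ i)) m)"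

definition formal_comp :: "fps3^3 \<Rightarrow> fps3^3 \<Rightarrow> fps3^3" where
  "formal_comp F \<Phi> = (\<chi> i. fps3_compose (F $ i) \<Phi>)"

definition formal_id :: "fps3^3" where
  "formal_id = (\<chi> i. fps3_var i)"

definition formal_change_of_variables :: "fps3^3 \<Rightarrow> bool" where
  "formal_change_of_variables \<Phi> \<longleftrightarrow> formal_fixes_origin \<Phi> \<and>
     (\<exists>\<Psi>. formal_fixes_origin \<Psi> \<and> formal_comp \<Phi> \<Psi> = formal_id \<and> formal_comp \<Psi> \<Phi> = formal_id)"

definition formal_jacobian :: "fps3^3 \<Rightarrow> fps3^3^3" where
  "formal_jacobian \<Phi> = (\<chi> i j. fps3_pderiv j (\<Phi> $ i))"

text \<open>
  Writing the old variables as \<open>v = \<Phi>(u)\<close>, the chain rule turns \<open>v' = F(v)\<close> into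
  \<open>D\<Phi>(u) u' = F(\<Phi>(u))\<close>; the system in the new variables is \<open>u' = G(u)\<close>.
\<close>

definition formally_transforms :: "fps3^3 \<Rightarrow> fps3^3 \<Rightarrow> fps3^3 \<Rightarrow> bool" where
  "formally_transforms \<Phi> F G \<longleftrightarrow> formal_jacobian \<Phi> *v G = formal_comp F \<Phi>"

end

theory Submission imports Defs
begin

text \<open>
  With \<open>\<Phi> = id + \<phi>\<close>, linear part \<open>A\<close>, nonlinear part \<open>f\<close> and target \<open>A + g\<close>, the conjugacy
  equation reads \<open>L \<phi> + g = f \<circ> (id + \<phi>) - D\<phi> \<cdot> g\<close>, where \<open>L \<phi> = D\<phi> \<cdot> A - A \<phi>\<close>.  Explicit
  linear maps \<open>\<sigma>\<close>, \<open>\<gamma>\<close>, which do not lower the order of vanishing, satisfy \<open>L (\<sigma> H) + \<gamma> H = H\<close>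
  with \<open>\<gamma> H\<close> in normal form.  Hence it suffices to find a fixed point of
  \<open>H \<mapsto> f \<circ> (id + \<sigma> H) - D(\<sigma> H) \<cdot> \<gamma> H\<close>.  As \<open>f\<close> has order 2, this map raises the order of differences
  by one and so is a contraction for the adic topology.  The same fixed point argument
  gives a right inverse of \<open>id + \<phi>\<close>; associativity of substitution makes it two-sided.
\<close>

section \<open>Coefficients and order of vanishing\<close>

lemma ex_vector3: "\<exists>i j k. (m::nat^3) = vector [i, j, k]"
  by (rule exI[of _ "m $ 1"], rule exI[of _ "m $ 2"], rule exI[of _ "m $ 3"])
    (simp add: vec_eq_iff forall_3)

lemma all_vector3_iff: "(\<forall>m::nat^3. p m) \<longleftrightarrow> (\<forall>i j k. p (vector [i, j, k]))"
  by (metis ex_vector3)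

lemma vector3_add [simp]: "(vector [i, j, k] :: nat^3) + vector [i', j', k'] = vector [i + i', j + j', k + k']"
  by (simp add: vec_eq_iff forall_3)

lemma axis_eq_vector3:
  "axis 1 n = (vector [n, 0, 0] :: nat^3)"
  "axis 2 n = (vector [0, n, 0] :: nat^3)"
  "axis 3 n = (vector [0, 0, n] :: nat^3)"
  by (auto simp: vec_eq_iff forall_3 axis_def)

lemma vector3_eq_iff [simp]: "(vector [i, j, k] :: nat^3) = vector [i', j', k'] \<longleftrightarrow> i = i' \<and> j = j' \<and> k = k'"
  by (simp add: vec_eq_iff forall_3)

lemma mdegree_vector3 [simp]: "mdegree (vector [i, j, k]) = i + j + k"
  by (simp add: mdegree_def sum_3)

lemma mdegree_add [simp]: "mdegree (m + m') = mdegree m + mdegree m'"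
  by (simp add: mdegree_def sum.distrib)

lemma mdegree_zero [simp]: "mdegree 0 = 0"
  by (simp add: mdegree_def)

lemma mdegree_eq_0_iff [simp]: "mdegree m = 0 \<longleftrightarrow> m = 0"
  by (simp add: mdegree_def vec_eq_iff)

lemma mdegree_axis [simp]: "mdegree (axis i n) = n"
  by (simp add: mdegree_def axis_def)

abbreviation fps3_coeff :: "fps3 \<Rightarrow> nat \<Rightarrow> nat \<Rightarrow> nat \<Rightarrow> real" where
  "fps3_coeff F i j k \<equiv> fps_nth (fps_nth (fps_nth F i) j) k"

lemma fps3_nth_vector3 [simp]: "fps3_nth F (vector [i, j, k]) = fps3_coeff F i j k"
  by (simp add: fps3_nth_def)

lemma fps3_nth_zero [simp]: "fps3_nth 0 m = 0"
  by (simp add: fps3_nth_def)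

lemma fps3_nth_add [simp]: "fps3_nth (F + G) m = fps3_nth F m + fps3_nth G m"
  by (simp add: fps3_nth_def)

lemma fps3_nth_diff [simp]: "fps3_nth (F - G) m = fps3_nth F m - fps3_nth G m"
  by (simp add: fps3_nth_def)

lemma fps3_nth_uminus [simp]: "fps3_nth (- F) m = - fps3_nth F m"
  by (simp add: fps3_nth_def)

lemma fps3_nth_const_mult [simp]: "fps3_nth (fps3_const c * F) m = c * fps3_nth F m"
  by (simp add: fps3_nth_def fps3_const_def)

lemma fps3_nth_one: "fps3_nth 1 m = (if m = 0 then 1 else 0)"
  by (auto simp: fps3_nth_def vec_eq_iff forall_3)

lemma fps3_nth_var: "fps3_nth (fps3_var i) m = (if m = axis i 1 then 1 else 0)"
  by (simp add: fps3_var_def)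

lemma fps3_var_eq:
  "fps3_var 1 = fps_X"
  "fps3_var 2 = fps_const fps_X"
  "fps3_var 3 = fps_const (fps_const fps_X)"
  by (auto simp: fps3_eq_iff all_vector3_iff fps3_nth_var axis_eq_vector3 fps_X_def)

text \<open>The three nested Cauchy products sum over a box of triples; this bijection turns that
  box into the pairs of multi-indices with a given sum.\<close>

lemma bij_betw_vector3_pairs:
  "bij_betw (\<lambda>(a, b, c). (vector [a, b, c], vector [i - a, j - b, k - c]))
     ({0..i} \<times> {0..j} \<times> {0..k}) {(p, q :: nat^3). p + q = vector [i, j, k]}"
proof (rule bij_betw_imageI)
  show "inj_on (\<lambda>(a, b, c). (vector [a, b, c] :: nat^3, vector [i - a, j - b, k - c] :: nat^3))
     ({0..i} \<times> {0..j} \<times> {0..k})"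
    by (auto simp: inj_on_def)
  show "(\<lambda>(a, b, c). (vector [a, b, c], vector [i - a, j - b, k - c])) `
     ({0..i} \<times> {0..j} \<times> {0..k}) = {(p, q :: nat^3). p + q = vector [i, j, k]}" (is "?f ` ?A = ?B")
  proof (intro equalityI subsetI)
    fix x assume "x \<in> ?B"
    then obtain p q where x: "x = (p, q)" "p + q = vector [i, j, k]" by auto
    obtain a b c where p: "p = vector [a, b, c]" using ex_vector3 by blast
    obtain a' b' c' where q: "q = vector [a', b', c']" using ex_vector3 by blast
    show "x \<in> ?f ` ?A"
      by (rule image_eqI[of _ _ "(a, b, c)"]) (use x p q in auto)
  qed auto
qed

lemma finite_vector3_pairs [simp]: "finite {(p, q :: nat^3). p + q = m}"
proof -
  obtain i j k where "m = vector [i, j, k]" using ex_vector3 by blast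
  then show ?thesis using bij_betw_finite[OF bij_betw_vector3_pairs, of i j k] by simp
qed

lemma fps3_nth_mult:
  "fps3_nth (F * G) m = (\<Sum>(p, q) | p + q = m. fps3_nth F p * fps3_nth G q)"
proof -
  obtain i j k where m: "m = vector [i, j, k]" using ex_vector3 by blast
  have "fps3_nth (F * G) m
    = (\<Sum>a=0..i. \<Sum>b=0..j. \<Sum>c=0..k. fps3_coeff F a b c * fps3_coeff G (i - a) (j - b) (k - c))"
    by (simp add: m fps_mult_nth fps_sum_nth)
  also have "\<dots> = (\<Sum>(a, b, c)\<in>{0..i} \<times> {0..j} \<times> {0..k}. fps3_coeff F a b c * fps3_coeff G (i - a) (j - b) (k - c))"
    by (simp add: sum.cartesian_product)
  also have "\<dots> = (\<Sum>(p, q) | p + q = m. fps3_nth F p * fps3_nth G q)"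
    unfolding m sum.reindex_bij_betw[OF bij_betw_vector3_pairs, symmetric]
    by (auto intro!: sum.cong)
  finally show ?thesis .
qed

text \<open>Membership in the \<open>n\<close>-th power of the maximal ideal. Recording only a lower
  bound lets the zero series have every order.\<close>

definition order_ge :: "nat \<Rightarrow> fps3 \<Rightarrow> bool" where
  "order_ge n F \<longleftrightarrow> (\<forall>m. mdegree m < n \<longrightarrow> fps3_nth F m = 0)"

lemma order_geD: "order_ge n F \<Longrightarrow> mdegree m < n \<Longrightarrow> fps3_nth F m = 0"
  by (simp add: order_ge_def)

lemma order_ge_0 [simp]: "order_ge 0 F"
  by (simp add: order_ge_def)

lemma order_ge_zero [simp]: "order_ge n 0"
  by (simp add: order_ge_def)

lemma order_ge_mono: "order_ge n F \<Longrightarrow> k \<le> n \<Longrightarrow> order_ge k F"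
  by (simp add: order_ge_def)

lemma order_ge_add: "order_ge n F \<Longrightarrow> order_ge n G \<Longrightarrow> order_ge n (F + G)"
  by (simp add: order_ge_def)

lemma order_ge_diff: "order_ge n F \<Longrightarrow> order_ge n G \<Longrightarrow> order_ge n (F - G)"
  by (simp add: order_ge_def)

lemma order_ge_uminus: "order_ge n F \<Longrightarrow> order_ge n (- F)"
  by (simp add: order_ge_def)

lemma order_ge_sum: "(\<And>x. x \<in> A \<Longrightarrow> order_ge n (F x)) \<Longrightarrow> order_ge n (sum F A)"
  by (induction A rule: infinite_finite_induct) (auto intro: order_ge_add)

lemma order_ge_mult:
  assumes "order_ge n F" "order_ge n' G" shows "order_ge (n + n') (F * G)"
  unfolding order_ge_def fps3_nth_mult
proof (intro allI impI sum.neutral ballI)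
  fix m x assume m: "mdegree m < n + n'" and "x \<in> {(p, q). p + q = m}"
  then obtain p q where x: "x = (p, q)" "p + q = m" by auto
  then have "mdegree p < n \<or> mdegree q < n'" using m by auto
  then show "(case x of (p, q) \<Rightarrow> fps3_nth F p * fps3_nth G q) = 0"
    using assms x by (auto dest: order_geD)
qed

lemma order_ge_power: "order_ge n F \<Longrightarrow> order_ge (n * k) (F ^ k)"
  by (induction k) (auto intro: order_ge_mult)

lemma order_ge_var: "order_ge 1 (fps3_var i)"
  by (auto simp: order_ge_def fps3_nth_var)

lemma order_ge_const_mult: "order_ge n F \<Longrightarrow> order_ge n (fps3_const c * F)"
  by (simp add: order_ge_def)

lemma order_ge_pderiv: "order_ge (Suc n) F \<Longrightarrow> order_ge n (fps3_pderiv i F)"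
  by (simp add: order_ge_def fps3_pderiv_def)

text \<open>The derivative costs one degree and the variable gives it back.\<close>

lemma order_ge_var_mult_pderiv:
  assumes "order_ge n F" shows "order_ge n (fps3_var i * fps3_pderiv j F)"
proof (cases n)
  case (Suc k)
  then show ?thesis
    using order_ge_mult[OF order_ge_var order_ge_pderiv, of k F i j] assms by simp
qed simp

text \<open>The adic topology is separated, since each coefficient has a finite degree.\<close>

lemma order_ge_all_imp_zero: "(\<And>n. order_ge n F) \<Longrightarrow> F = 0"
  unfolding fps3_eq_iff fps3_nth_zero by (meson order_geD lessI)

lemma order_ge_Suc_iff_fps3_jet: "order_ge (Suc n) F \<longleftrightarrow> fps3_jet n F = 0"
  by (simp add: order_ge_def fps3_eq_iff fps3_jet_def less_Suc_eq_le)

definition vec_order_ge :: "nat \<Rightarrow> fps3^3 \<Rightarrow> bool" where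
  "vec_order_ge n H \<longleftrightarrow> (\<forall>i. order_ge n (H $ i))"

lemma vec_order_geD: "vec_order_ge n H \<Longrightarrow> order_ge n (H $ i)"
  by (simp add: vec_order_ge_def)

lemma vec_order_ge_zero [simp]: "vec_order_ge n 0"
  by (simp add: vec_order_ge_def)

lemma vec_order_ge_mono: "vec_order_ge n H \<Longrightarrow> k \<le> n \<Longrightarrow> vec_order_ge k H"
  by (auto simp: vec_order_ge_def intro: order_ge_mono)

lemma vec_order_ge_add: "vec_order_ge n H \<Longrightarrow> vec_order_ge n K \<Longrightarrow> vec_order_ge n (H + K)"
  by (simp add: vec_order_ge_def order_ge_add)

lemma vec_order_ge_diff: "vec_order_ge n H \<Longrightarrow> vec_order_ge n K \<Longrightarrow> vec_order_ge n (H - K)"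
  by (simp add: vec_order_ge_def order_ge_diff)

lemma vec_order_ge_uminus: "vec_order_ge n H \<Longrightarrow> vec_order_ge n (- H)"
  by (simp add: vec_order_ge_def order_ge_uminus)


section \<open>Fixed points of contractions\<close>

text \<open>Banach's theorem with orders of vanishing in place of a metric: the iterates of
  \<open>T\<close> from 0 settle coefficient by coefficient.\<close>

lemma contraction_fixpoint:
  fixes T :: "fps3^3 \<Rightarrow> fps3^3"
  assumes pres: "\<And>H. vec_order_ge 2 H \<Longrightarrow> vec_order_ge 2 (T H)"
    and contr: "\<And>n H K. vec_order_ge 2 H \<Longrightarrow> vec_order_ge 2 K \<Longrightarrow> vec_order_ge n (H - K)
      \<Longrightarrow> vec_order_ge (Suc n) (T H - T K)"
  obtains H where "vec_order_ge 2 H" "T H = H"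
proof -
  define s where "s k = (T ^^ k) 0" for k
  have s_Suc: "s (Suc k) = T (s k)" for k by (simp add: s_def)
  have s2: "vec_order_ge 2 (s k)" for k
    by (induction k) (simp_all add: s_Suc pres, simp add: s_def)
  \<comment> \<open>The offset 2 comes from the first two iterates, both of order 2; each
    application of \<open>T\<close> gains one more order.\<close>
  have step: "vec_order_ge (k + 2) (s (Suc k) - s k)" for k
  proof (induction k)
    case 0
    show ?case using vec_order_ge_diff[OF s2 s2, of "Suc 0" 0] by (simp add: numeral_2_eq_2)
  next
    case (Suc k)
    show ?case using contr[OF s2 s2 Suc] by (simp add: s_Suc)
  qed
  have tail: "vec_order_ge (k + 2) (s (k + d) - s k)" for k d
  proof (induction d)
    case (Suc d)
    have "vec_order_ge (k + 2) (s (Suc (k + d)) - s (k + d))"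
      by (rule vec_order_ge_mono[OF step]) simp
    from vec_order_ge_add[OF this Suc] show ?case by simp
  qed simp
  \<comment> \<open>By \<open>tail\<close>, coefficients of degree \<open>d\<close> no longer change
    from \<open>s d\<close> on, so this diagonal choice is the limit.\<close>
  define L :: "fps3^3" where "L = (\<chi> i. Abs_fps3 (\<lambda>m. fps3_nth (s (mdegree m) $ i) m))"
  have L: "vec_order_ge (k + 2) (L - s k)" for k
    unfolding vec_order_ge_def order_ge_def
  proof (intro allI impI)
    fix i m assume m: "mdegree m < k + 2"
    have "fps3_nth (s (mdegree m) $ i) m = fps3_nth (s k $ i) m"
    proof (cases "k \<le> mdegree m")
      case True
      then show ?thesis
        using order_geD[OF vec_order_geD[OF tail[of k "mdegree m - k"]] m] by simp
    next
      case False
      then show ?thesis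
        using order_geD[OF vec_order_geD[OF tail[of "mdegree m" "k - mdegree m"]], of m] by simp
    qed
    then show "fps3_nth ((L - s k) $ i) m = 0" by (simp add: L_def)
  qed
  have L2: "vec_order_ge 2 L" using L[of 0] by (simp add: s_def numeral_2_eq_2)
  \<comment> \<open>Both \<open>T L\<close> and \<open>L\<close> are close to
    \<open>s (Suc n) = T (s n)\<close>, so their difference has arbitrarily high order.\<close>
  have "vec_order_ge n (T L - L)" for n
  proof -
    have "vec_order_ge (Suc (n + 2)) (T L - T (s n))" by (rule contr[OF L2 s2 L])
    moreover have "vec_order_ge (Suc (n + 2)) (L - T (s n))"
      using L[of "Suc n"] by (simp add: s_Suc)
    ultimately have "vec_order_ge (Suc (n + 2)) (T L - L)"
      using vec_order_ge_diff by fastforce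
    then show ?thesis by (rule vec_order_ge_mono) simp
  qed
  then have "(T L - L) $ i = 0" for i
    by (intro order_ge_all_imp_zero vec_order_geD)
  then have "T L = L" by (simp add: vec_eq_iff)
  with L2 that show ?thesis by blast
qed


section \<open>Substitution of formal maps\<close>

text \<open>Names the product inside \<open>fps3_compose\<close>, so that its order and its
  behaviour under sums of exponents can be treated apart.\<close>

definition monom_subst :: "fps3^3 \<Rightarrow> nat^3 \<Rightarrow> fps3" where
  "monom_subst \<Phi> a = (\<Prod>i\<in>UNIV. (\<Phi> $ i) ^ (a $ i))"

lemma monom_subst_add: "monom_subst \<Phi> (a + b) = monom_subst \<Phi> a * monom_subst \<Phi> b"
  by (simp add: monom_subst_def power_add prod.distrib)

lemma monom_subst_3: "monom_subst \<Phi> a = (\<Phi> $ 1) ^ (a $ 1) * (\<Phi> $ 2) ^ (a $ 2) * (\<Phi> $ 3) ^ (a $ 3)"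
  unfolding monom_subst_def UNIV_3 by (simp add: mult.assoc)

lemma formal_fixes_origin_iff: "formal_fixes_origin \<Phi> \<longleftrightarrow> vec_order_ge 1 \<Phi>"
  by (auto simp: formal_fixes_origin_def vec_order_ge_def order_ge_def)

lemma order_ge_monom_subst:
  assumes "formal_fixes_origin \<Phi>" shows "order_ge (mdegree a) (monom_subst \<Phi> a)"
proof -
  have "order_ge (a $ i) (\<Phi> $ i ^ (a $ i))" for i
    using order_ge_power[of 1 "\<Phi> $ i" "a $ i"] assms
    by (simp add: formal_fixes_origin_iff vec_order_ge_def)
  then have "order_ge (a $ 1 + a $ 2 + a $ 3) (monom_subst \<Phi> a)"
    unfolding monom_subst_3 by (intro order_ge_mult)
  then show ?thesis by (simp add: mdegree_def sum_3)
qed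

text \<open>Exponents of degree above \<open>mdegree m\<close> contribute nothing, because
  \<open>monom_subst \<Phi> a\<close> has order \<open>mdegree a\<close>. The free bound
  \<open>N\<close> allows one common cutoff for several coefficients.\<close>

lemma fps3_nth_compose:
  assumes "formal_fixes_origin \<Phi>" "mdegree m \<le> N"
  shows "fps3_nth (fps3_compose F \<Phi>) m
    = (\<Sum>a | mdegree a \<le> N. fps3_nth F a * fps3_nth (monom_subst \<Phi> a) m)"
proof -
  have "fps3_nth (fps3_compose F \<Phi>) m
    = (\<Sum>a | mdegree a \<le> mdegree m. fps3_nth F a * fps3_nth (monom_subst \<Phi> a) m)"
    by (simp add: fps3_compose_def monom_subst_def)
  also have "\<dots> = (\<Sum>a | mdegree a \<le> N. fps3_nth F a * fps3_nth (monom_subst \<Phi> a) m)"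
    using assms by (intro sum.mono_neutral_left) (auto simp: order_geD[OF order_ge_monom_subst])
  finally show ?thesis .
qed

section \<open>Algebraic laws of substitution\<close>

lemma fps3_compose_add: "fps3_compose (F + G) \<Phi> = fps3_compose F \<Phi> + fps3_compose G \<Phi>"
  by (simp add: fps3_eq_iff fps3_compose_def algebra_simps sum.distrib)

lemma fps3_compose_uminus: "fps3_compose (- F) \<Phi> = - fps3_compose F \<Phi>"
  by (simp add: fps3_eq_iff fps3_compose_def sum_negf)

lemma fps3_compose_const_mult: "fps3_compose (fps3_const c * F) \<Phi> = fps3_const c * fps3_compose F \<Phi>"
  by (simp add: fps3_eq_iff fps3_compose_def sum_distrib_left mult.assoc)

lemma fps3_compose_one: "fps3_compose 1 \<Phi> = 1"
  by (simp add: fps3_eq_iff fps3_compose_def fps3_nth_one if_distrib[of "\<lambda>x. x * _"] cong: if_cong)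

lemma fps3_compose_var:
  assumes "formal_fixes_origin \<Phi>" shows "fps3_compose (fps3_var i) \<Phi> = \<Phi> $ i"
proof -
  have "monom_subst \<Phi> (axis i 1) = \<Phi> $ i"
    using exhaust_3[of i] by (auto simp: monom_subst_3 axis_eq_vector3)
  moreover have "fps3_nth (fps3_compose (fps3_var i) \<Phi>) m = fps3_nth (monom_subst \<Phi> (axis i 1)) m" for m
    \<comment> \<open>The cutoff is \<open>Suc (mdegree m)\<close>, so that \<open>axis i 1\<close>,
      of degree 1, is in range even for \<open>m = 0\<close>.\<close>
    unfolding fps3_nth_compose[OF assms le_SucI[OF le_refl]] fps3_nth_var
    by (simp add: if_distrib[of "\<lambda>x. x * _"] cong: if_cong)
  ultimately show ?thesis by (simp add: fps3_eq_iff)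
qed

lemma sum_swap_innermost:
  "(\<Sum>b\<in>B. \<Sum>c\<in>C. \<Sum>x\<in>A. f b c x) = (\<Sum>x\<in>A. \<Sum>b\<in>B. \<Sum>c\<in>C. f b c x)"
proof -
  have "(\<Sum>b\<in>B. \<Sum>c\<in>C. \<Sum>x\<in>A. f b c x) = (\<Sum>b\<in>B. \<Sum>x\<in>A. \<Sum>c\<in>C. f b c x)"
    by (intro sum.cong refl sum.swap)
  also have "\<dots> = (\<Sum>x\<in>A. \<Sum>b\<in>B. \<Sum>c\<in>C. f b c x)"
    by (rule sum.swap)
  finally show ?thesis .
qed

lemma fps3_compose_mult:
  assumes "formal_fixes_origin \<Phi>"
  shows "fps3_compose (F * G) \<Phi> = fps3_compose F \<Phi> * fps3_compose G \<Phi>"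
  unfolding fps3_eq_iff
proof
  fix m
  define B :: "(nat^3) set" where "B = {a. mdegree a \<le> mdegree m}"
  define t where "t b c = fps3_nth F b * fps3_nth G c * fps3_nth (monom_subst \<Phi> (b + c)) m" for b c
  have finB: "finite B" by (simp add: B_def)
  have "fps3_nth (fps3_compose (F * G) \<Phi>) m
    = (\<Sum>a\<in>B. \<Sum>(b, c) | b + c = a. t b c)"
    by (auto simp: fps3_nth_compose[OF assms le_refl] B_def fps3_nth_mult sum_distrib_right t_def
        intro!: sum.cong)
  also have "\<dots> = (\<Sum>(b, c)\<in>{(b, c). b + c \<in> B}. t b c)"
  proof -
    have "(\<Sum>a\<in>B. \<Sum>(b, c) | b + c = a. t b c)
      = (\<Sum>(a, b, c)\<in>(SIGMA a:B. {(b, c). b + c = a}). t b c)"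
      by (subst sum.Sigma) (auto simp: finB)
    also have "\<dots> = (\<Sum>(b, c)\<in>{(b, c). b + c \<in> B}. t b c)"
      by (rule sum.reindex_bij_witness[of _ "\<lambda>(b, c). (b + c, b, c)" "\<lambda>(a, b, c). (b, c)"]) auto
    finally show ?thesis .
  qed
  \<comment> \<open>The pairs added to fill up the square have \<open>b + c\<close> of degree above
    \<open>mdegree m\<close>, where \<open>monom_subst \<Phi> (b + c)\<close> has no coefficient at
    \<open>m\<close>.\<close>
  also have "\<dots> = (\<Sum>(b, c)\<in>B \<times> B. t b c)"
  proof (rule sum.mono_neutral_left)
    have "t b c = 0" if "b + c \<notin> B" for b c
      using order_geD[OF order_ge_monom_subst[OF assms], of m "b + c"] that
      by (simp add: t_def B_def)
    then show "\<forall>x\<in>B \<times> B - {(b, c). b + c \<in> B}. (case x of (b, c) \<Rightarrow> t b c) = 0"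
      by auto
  qed (auto simp: finB, auto simp: B_def)
  also have "\<dots> = (\<Sum>b\<in>B. \<Sum>c\<in>B. \<Sum>(p, q) | p + q = m.
      (fps3_nth F b * fps3_nth (monom_subst \<Phi> b) p) * (fps3_nth G c * fps3_nth (monom_subst \<Phi> c) q))"
    by (auto simp: sum.cartesian_product[symmetric] t_def monom_subst_add fps3_nth_mult sum_distrib_left
        mult_ac intro!: sum.cong)
  also have "\<dots> = (\<Sum>(p, q) | p + q = m. \<Sum>b\<in>B. \<Sum>c\<in>B.
      (fps3_nth F b * fps3_nth (monom_subst \<Phi> b) p) * (fps3_nth G c * fps3_nth (monom_subst \<Phi> c) q))"
    unfolding case_prod_unfold by (rule sum_swap_innermost)
  \<comment> \<open>Since \<open>p\<close> and \<open>q\<close> have degree at most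
    \<open>mdegree m\<close>, the cutoff \<open>B\<close> serves both factors.\<close>
  also have "\<dots> = (\<Sum>(p, q) | p + q = m. fps3_nth (fps3_compose F \<Phi>) p * fps3_nth (fps3_compose G \<Phi>) q)"
    by (auto simp: fps3_nth_compose[OF assms, of _ "mdegree m"] B_def sum_product intro!: sum.cong)
  finally show "fps3_nth (fps3_compose (F * G) \<Phi>) m = fps3_nth (fps3_compose F \<Phi> * fps3_compose G \<Phi>) m"
    by (simp add: fps3_nth_mult)
qed

lemma fps3_compose_power:
  "formal_fixes_origin \<Phi> \<Longrightarrow> fps3_compose (F ^ n) \<Phi> = fps3_compose F \<Phi> ^ n"
  by (induction n) (simp_all add: fps3_compose_one fps3_compose_mult)

lemma fps3_compose_monom_subst:
  "formal_fixes_origin \<Psi> \<Longrightarrow> fps3_compose (monom_subst \<Phi> a) \<Psi> = monom_subst (formal_comp \<Phi> \<Psi>) a"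
  by (simp add: monom_subst_3 fps3_compose_mult fps3_compose_power formal_comp_def)

lemma formal_fixes_origin_comp:
  assumes "formal_fixes_origin \<Phi>" shows "formal_fixes_origin (formal_comp \<Phi> \<Psi>)"
  using assms by (simp add: formal_fixes_origin_def formal_comp_def fps3_compose_def)

text \<open>Multiplicativity settles the case of monomials; the general case then exchanges two
  finite sums that share the cutoff \<open>mdegree m\<close>.\<close>

lemma fps3_compose_assoc:
  assumes "formal_fixes_origin \<Phi>" "formal_fixes_origin \<Psi>"
  shows "fps3_compose F (formal_comp \<Phi> \<Psi>) = fps3_compose (fps3_compose F \<Phi>) \<Psi>"
  unfolding fps3_eq_iff
proof
  fix m
  let ?B = "{a. mdegree a \<le> mdegree m}"
  have "fps3_nth (fps3_compose F (formal_comp \<Phi> \<Psi>)) m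
    = (\<Sum>a\<in>?B. \<Sum>b\<in>?B. fps3_nth F a * fps3_nth (monom_subst \<Phi> a) b * fps3_nth (monom_subst \<Psi> b) m)"
    by (simp add: fps3_nth_compose[OF formal_fixes_origin_comp[OF assms(1)] le_refl]
        fps3_compose_monom_subst[OF assms(2), symmetric] fps3_nth_compose[OF assms(2) le_refl]
        sum_distrib_left mult.assoc)
  also have "\<dots> = (\<Sum>b\<in>?B. \<Sum>a\<in>?B. fps3_nth F a * fps3_nth (monom_subst \<Phi> a) b * fps3_nth (monom_subst \<Psi> b) m)"
    by (rule sum.swap)
  also have "\<dots> = fps3_nth (fps3_compose (fps3_compose F \<Phi>) \<Psi>) m"
    by (auto simp: fps3_nth_compose[OF assms(2) le_refl] fps3_nth_compose[OF assms(1), of _ "mdegree m"]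
        sum_distrib_right intro!: sum.cong)
  finally show "fps3_nth (fps3_compose F (formal_comp \<Phi> \<Psi>)) m
    = fps3_nth (fps3_compose (fps3_compose F \<Phi>) \<Psi>) m" .
qed

lemma formal_comp_assoc:
  "formal_fixes_origin \<Phi> \<Longrightarrow> formal_fixes_origin \<Psi> \<Longrightarrow>
    formal_comp F (formal_comp \<Phi> \<Psi>) = formal_comp (formal_comp F \<Phi>) \<Psi>"
  by (simp add: formal_comp_def[of F] formal_comp_def[of "formal_comp _ _"]
      formal_comp_def[of "\<chi> i. _ i"] fps3_compose_assoc vec_eq_iff)

section \<open>The identity map and its perturbations\<close>

lemma formal_id_nth: "formal_id $ i = fps3_var i"
  by (simp add: formal_id_def)

lemma formal_comp_id_left: "formal_fixes_origin \<Phi> \<Longrightarrow> formal_comp formal_id \<Phi> = \<Phi>"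
  by (simp add: formal_comp_def formal_id_def fps3_compose_var vec_eq_iff)

lemma formal_comp_add: "formal_comp (F + G) \<Phi> = formal_comp F \<Phi> + formal_comp G \<Phi>"
  by (simp add: formal_comp_def fps3_compose_add vec_eq_iff)

lemma vec_order_ge_formal_id: "vec_order_ge 1 formal_id"
  by (simp add: vec_order_ge_def formal_id_def order_ge_var[simplified])

lemma formal_fixes_origin_near_id: "vec_order_ge 2 \<phi> \<Longrightarrow> formal_fixes_origin (formal_id + \<phi>)"
  unfolding formal_fixes_origin_iff
  by (intro vec_order_ge_add vec_order_ge_formal_id) (auto intro: vec_order_ge_mono)

lemma fps3_nth_monom_subst_id: "fps3_nth (monom_subst formal_id a) m = (if m = a then 1 else 0)"
proof -
  obtain i j k where a: "a = vector [i, j, k]" using ex_vector3 by blast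
  obtain x y z where m: "m = vector [x, y, z]" using ex_vector3 by blast
  have "monom_subst formal_id a = fps_X ^ i * fps_const (fps_X ^ j) * fps_const (fps_const (fps_X ^ k))"
    by (simp only: a monom_subst_3 formal_id_def vec_lambda_beta fps3_var_eq vector_3 fps_const_power)
  then show ?thesis by (simp add: a m fps_X_power_nth)
qed

lemma formal_comp_id_right: "formal_comp F formal_id = F"
proof -
  have "fps3_compose G formal_id = G" for G
    by (simp add: fps3_eq_iff fps3_compose_def monom_subst_def[symmetric]
        fps3_nth_monom_subst_id if_distrib[of "\<lambda>x. _ * x"] cong: if_cong)
  then show ?thesis by (simp add: formal_comp_def vec_eq_iff)
qed

section \<open>Order estimates for differences of substitutions\<close>

lemma order_ge_power_diff:
  assumes "order_ge 1 F" "order_ge 1 G" "order_ge (Suc n) (F - G)"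
  shows "order_ge (n + k) (F ^ k - G ^ k)"
proof (induction k)
  case (Suc k)
  have "order_ge (1 + (n + k)) (F * (F ^ k - G ^ k))"
    by (rule order_ge_mult[OF assms(1) Suc])
  moreover have "order_ge (Suc n + 1 * k) ((F - G) * G ^ k)"
    by (rule order_ge_mult[OF assms(3) order_ge_power[OF assms(2)]])
  \<comment> \<open>This sum is \<open>F ^ Suc k - G ^ Suc k\<close>, telescoped.\<close>
  ultimately have "order_ge (n + Suc k) (F * (F ^ k - G ^ k) + (F - G) * G ^ k)"
    by (intro order_ge_add) simp_all
  then show ?case by (simp add: algebra_simps)
qed simp

lemma order_ge_mult_diff:
  assumes "order_ge a F" "order_ge (n + a) (F - F')" "order_ge b G'" "order_ge (n + b) (G - G')"
  shows "order_ge (n + (a + b)) (F * G - F' * G')"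
proof -
  have "order_ge (a + (n + b)) (F * (G - G'))" by (rule order_ge_mult[OF assms(1,4)])
  moreover have "order_ge (n + a + b) ((F - F') * G')" by (rule order_ge_mult[OF assms(2,3)])
  ultimately have "order_ge (n + (a + b)) (F * (G - G') + (F - F') * G')"
    by (intro order_ge_add) (simp_all add: ac_simps)
  then show ?thesis by (simp add: algebra_simps)
qed

text \<open>The perturbation exceeds the order 1 of the components by \<open>n\<close>, and this
  excess over the natural order passes to powers and products.\<close>

lemma order_ge_monom_subst_diff:
  assumes "vec_order_ge 1 \<Phi>" "vec_order_ge 1 \<Psi>" "vec_order_ge (Suc n) (\<Phi> - \<Psi>)"
  shows "order_ge (n + mdegree a) (monom_subst \<Phi> a - monom_subst \<Psi> a)"
proof -
  have 1: "order_ge (k) (\<Phi> $ i ^ k)" "order_ge k (\<Psi> $ i ^ k)" for i :: 3 and k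
    using order_ge_power[OF vec_order_geD[OF assms(1), of i], of k]
      order_ge_power[OF vec_order_geD[OF assms(2), of i], of k] by simp_all
  have 2: "order_ge (n + k) (\<Phi> $ i ^ k - \<Psi> $ i ^ k)" for i :: 3 and k
    using assms by (intro order_ge_power_diff) (simp_all add: vec_order_ge_def)
  have "order_ge (n + (a $ 1 + a $ 2 + a $ 3)) (monom_subst \<Phi> a - monom_subst \<Psi> a)"
    unfolding monom_subst_3 by (intro order_ge_mult_diff order_ge_mult 1 2)
  then show ?thesis by (simp add: mdegree_def sum_3)
qed

lemma order_ge_compose:
  assumes "order_ge n F" "formal_fixes_origin \<Phi>"
  shows "order_ge n (fps3_compose F \<Phi>)"
  using assms by (auto simp: order_ge_def fps3_compose_def intro!: sum.neutral)

text \<open>The source of the contraction: a perturbation of order \<open>n = Suc k\<close> changes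
  a monomial of degree \<open>d\<close> in order \<open>k + d\<close>, and only
  \<open>d \<ge> 2\<close> occurs in \<open>F\<close>. For \<open>n = 0\<close> the order 2 of both
  compositions suffices.\<close>

lemma order_ge_compose_diff:
  assumes F: "order_ge 2 F" and "vec_order_ge 1 \<Phi>" "vec_order_ge 1 \<Psi>" "vec_order_ge n (\<Phi> - \<Psi>)"
  shows "order_ge (Suc n) (fps3_compose F \<Phi> - fps3_compose F \<Psi>)"
proof (cases n)
  case 0
  have "order_ge 2 (fps3_compose F \<Phi> - fps3_compose F \<Psi>)"
    using assms by (intro order_ge_diff order_ge_compose) (auto simp: formal_fixes_origin_iff)
  then show ?thesis using 0 by (auto intro: order_ge_mono)
next
  case (Suc k)
  have "fps3_nth F a * fps3_nth (monom_subst \<Phi> a) m = fps3_nth F a * fps3_nth (monom_subst \<Psi> a) m"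
    if "mdegree m < Suc n" for a m
  proof (cases "mdegree a < 2")
    case False
    then have "mdegree m < k + mdegree a" using that Suc by simp
    then show ?thesis
      using order_geD[OF order_ge_monom_subst_diff[OF assms(2,3)], of k m a] assms(4) Suc by simp
  qed (simp add: order_geD[OF F])
  then show ?thesis
    by (auto simp: order_ge_def fps3_compose_def monom_subst_def[symmetric] intro!: sum.cong)
qed

lemma vec_order_ge_comp_diff:
  assumes "vec_order_ge 2 F" "vec_order_ge 2 \<phi>" "vec_order_ge 2 \<psi>" "vec_order_ge n (\<phi> - \<psi>)"
  shows "vec_order_ge (Suc n) (formal_comp F (formal_id + \<phi>) - formal_comp F (formal_id + \<psi>))"
  using assms formal_fixes_origin_near_id[of \<phi>] formal_fixes_origin_near_id[of \<psi>]
    order_ge_compose_diff[of "F $ _" "formal_id + \<phi>" "formal_id + \<psi>" n]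
  by (simp add: vec_order_ge_def[of "Suc n"] vec_order_ge_def[of 2 F] formal_comp_def formal_fixes_origin_iff)

lemma vec_order_ge_comp:
  "vec_order_ge n F \<Longrightarrow> formal_fixes_origin \<Phi> \<Longrightarrow> vec_order_ge n (formal_comp F \<Phi>)"
  by (simp add: vec_order_ge_def formal_comp_def order_ge_compose)

text \<open>Expanding the composition gives
  \<open>id + \<psi> + \<phi> \<circ> (id + \<psi>)\<close>, so the equation is the fixed point
  equation \<open>\<psi> = - \<phi> \<circ> (id + \<psi>)\<close>.\<close>

lemma right_inverse_near_id:
  assumes "vec_order_ge 2 \<phi>"
  obtains \<psi> where "vec_order_ge 2 \<psi>" "formal_comp (formal_id + \<phi>) (formal_id + \<psi>) = formal_id"
proof -
  obtain \<psi> where \<psi>: "vec_order_ge 2 \<psi>" "- formal_comp \<phi> (formal_id + \<psi>) = \<psi>"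
  proof (rule contraction_fixpoint[of "\<lambda>\<psi>. - formal_comp \<phi> (formal_id + \<psi>)"])
    show "vec_order_ge 2 (- formal_comp \<phi> (formal_id + H))" if "vec_order_ge 2 H" for H
      using assms that by (intro vec_order_ge_uminus vec_order_ge_comp formal_fixes_origin_near_id)
    show "vec_order_ge (Suc n) (- formal_comp \<phi> (formal_id + H) - - formal_comp \<phi> (formal_id + K))"
      if "vec_order_ge 2 H" "vec_order_ge 2 K" "vec_order_ge n (H - K)" for n H K
      using vec_order_ge_uminus[OF vec_order_ge_comp_diff[OF assms that]] by simp
  qed
  have "formal_comp (formal_id + \<phi>) (formal_id + \<psi>) = formal_id"
    using formal_fixes_origin_near_id[OF \<psi>(1)] \<psi>(2)
    by (simp add: formal_comp_add formal_comp_id_left add_eq_0_iff2 add.assoc neg_eq_iff_add_eq_0 add.commute)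
  with \<psi>(1) that show ?thesis by blast
qed

text \<open>The right inverse has a right inverse of its own, which by associativity equals the
  original map.\<close>

lemma formal_change_of_variables_near_id:
  assumes "vec_order_ge 2 \<phi>"
  shows "formal_change_of_variables (formal_id + \<phi>)"
proof -
  obtain \<psi> where \<psi>: "vec_order_ge 2 \<psi>" "formal_comp (formal_id + \<phi>) (formal_id + \<psi>) = formal_id"
    using right_inverse_near_id[OF assms] .
  obtain \<xi> where \<xi>: "vec_order_ge 2 \<xi>" "formal_comp (formal_id + \<psi>) (formal_id + \<xi>) = formal_id"
    using right_inverse_near_id[OF \<psi>(1)] .
  note o = assms \<psi>(1) \<xi>(1)
  note o = o[THEN formal_fixes_origin_near_id]
  have "formal_id + \<phi> = formal_id + \<xi>"
    using formal_comp_assoc[OF o(2,3), of "formal_id + \<phi>"] \<psi>(2) \<xi>(2)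
    by (simp add: formal_comp_id_left[OF o(3)] formal_comp_id_right)
  then show ?thesis
    unfolding formal_change_of_variables_def using o \<psi>(2) \<xi>(2) by metis
qed


section \<open>The homological equation\<close>

lemma fps3_coeff_pderiv:
  "fps3_coeff (fps3_pderiv 1 F) i j k = real (Suc i) * fps3_coeff F (Suc i) j k"
  "fps3_coeff (fps3_pderiv 3 F) i j k = real (Suc k) * fps3_coeff F i j (Suc k)"
  unfolding fps3_nth_vector3[symmetric] fps3_pderiv_def fps3_nth_Abs_fps3
  by (simp_all add: axis_eq_vector3)

lemma fps3_pderiv_add: "fps3_pderiv i (F + G) = fps3_pderiv i F + fps3_pderiv i G"
  by (simp add: fps3_pderiv_def fps3_eq_iff algebra_simps)

lemma fps3_pderiv_diff: "fps3_pderiv i (F - G) = fps3_pderiv i F - fps3_pderiv i G"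
  by (simp add: fps3_pderiv_def fps3_eq_iff algebra_simps)

lemma fps3_pderiv_var: "fps3_pderiv j (fps3_var i) = (if i = j then 1 else 0)"
proof -
  have "m + axis j 1 = axis i 1 \<longleftrightarrow> i = j \<and> m = 0" for m :: "nat^3"
  proof
    assume *: "m + axis j 1 = axis i 1"
    then have "mdegree (m + axis j 1) = mdegree (axis i 1 :: nat^3)" by (rule arg_cong)
    then have "m = 0" by (simp del: One_nat_def)
    with * show "i = j \<and> m = 0" by (simp add: axis_eq_axis)
  qed auto
  then show ?thesis
    by (auto simp: fps3_eq_iff fps3_pderiv_def fps3_nth_var fps3_nth_one axis_eq_axis simp del: One_nat_def)
qed

lemma fps3_coeff_of_fps: "fps3_coeff (fps3_of_fps A) i j k = (if j = 0 \<and> k = 0 then fps_nth A i else 0)"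
  by (simp add: fps3_of_fps_def fps3_nth_vector3[symmetric] del: fps3_nth_vector3)

lemma fps3_eqI: "(\<And>i j k. fps3_coeff F i j k = fps3_coeff G i j k) \<Longrightarrow> F = G"
  by (intro fps_ext)

lemma fps3_pderiv_of_fps:
  "fps3_pderiv 1 (fps3_of_fps A) = fps3_of_fps (fps_deriv A)"
  "fps3_pderiv 3 (fps3_of_fps A) = 0"
  by (auto intro!: fps3_eqI simp: fps3_coeff_pderiv fps3_coeff_of_fps)

lemma fps3_of_fps_uminus: "fps3_of_fps (- A) = - fps3_of_fps A"
  by (auto intro!: fps3_eqI simp: fps3_coeff_of_fps)

lemma order_ge_iff: "order_ge n F \<longleftrightarrow> (\<forall>i j k. i + j + k < n \<longrightarrow> fps3_coeff F i j k = 0)"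
  by (simp add: order_ge_def all_vector3_iff)

text \<open>
  Coefficientwise solution of \<open>y \<partial>\<^sub>x F + \<mu>\<^sub>k F = H\<close> on the part of degree \<open>k\<close> in \<open>z\<close>.  If
  \<open>\<mu>\<^sub>k \<noteq> 0\<close>, the operator is invertible since \<open>y \<partial>\<^sub>x\<close> is locally nilpotent; if \<open>\<mu>\<^sub>k = 0\<close>, only the
  coefficients of \<open>H\<close> at \<open>y\<^sup>0\<close> stay out of reach.  For \<open>i = 0\<close> the division by zero yields \<open>0\<close>.
\<close>

fun solve_coeff :: "(nat \<Rightarrow> real) \<Rightarrow> fps3 \<Rightarrow> nat \<Rightarrow> nat \<Rightarrow> nat \<Rightarrow> real" where
  "solve_coeff \<mu> H i 0 k =
    (if \<mu> k = 0 then fps3_coeff H (i - 1) 1 k / real i else fps3_coeff H i 0 k / \<mu> k)"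
| "solve_coeff \<mu> H i (Suc j) k =
    (if \<mu> k = 0 then fps3_coeff H (i - 1) (Suc (Suc j)) k / real i
     else (fps3_coeff H i (Suc j) k - real (Suc i) * solve_coeff \<mu> H (Suc i) j k) / \<mu> k)"

definition solve :: "(nat \<Rightarrow> real) \<Rightarrow> fps3 \<Rightarrow> fps3" where
  "solve \<mu> H = Abs_fps3 (\<lambda>m. solve_coeff \<mu> H (m $ 1) (m $ 2) (m $ 3))"

lemma fps3_coeff_solve [simp]: "fps3_coeff (solve \<mu> H) i j k = solve_coeff \<mu> H i j k"
  by (simp add: solve_def fps3_nth_vector3[symmetric] del: fps3_nth_vector3)

lemma solve_coeff_diff: "solve_coeff \<mu> (H - K) i j k = solve_coeff \<mu> H i j k - solve_coeff \<mu> K i j k"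
  by (induction j arbitrary: i) (auto simp: right_diff_distrib diff_divide_distrib simp del: of_nat_Suc)

lemma solve_diff: "solve \<mu> (H - K) = solve \<mu> H - solve \<mu> K"
  by (rule fps3_eqI) (simp add: solve_coeff_diff)

text \<open>The recursion reads \<open>H\<close> only at the same total degree, except that
  \<open>i - 1\<close> is truncated at \<open>i = 0\<close>; there the division by zero makes the
  value 0.\<close>

lemma solve_coeff_eq_0:
  "order_ge n H \<Longrightarrow> i + j + k < n \<Longrightarrow> solve_coeff \<mu> H i j k = 0"
proof (induction j arbitrary: i)
  case 0
  then show ?case by (cases i) (auto simp: order_ge_iff)
next
  case (Suc j)
  then show ?case by (cases i) (auto simp: order_ge_iff)
qed

lemma order_ge_solve: "order_ge n H \<Longrightarrow> order_ge n (solve \<mu> H)"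
  by (simp add: order_ge_iff[of n "solve \<mu> H"] solve_coeff_eq_0)

text \<open>\<open>y \<partial>\<^sub>x\<close> has no coefficients at \<open>j = 0\<close>; at
  \<open>j = Suc j'\<close> it yields \<open>Suc i\<close> times the coefficient at
  \<open>Suc i\<close>, \<open>j'\<close>, which the recursion of \<open>solve_coeff\<close>
  compensates.\<close>

lemma solve_coeff_equation:
  "fps3_coeff (fps3_var 2 * fps3_pderiv 1 (solve \<mu> H)) i j k + \<mu> k * solve_coeff \<mu> H i j k
    = (if j = 0 \<and> \<mu> k = 0 then 0 else fps3_coeff H i j k)"
proof (cases j)
  case (Suc j')
  then show ?thesis by (cases j') (auto simp: fps3_var_eq fps3_coeff_pderiv simp del: of_nat_Suc)
qed (simp add: fps3_var_eq)

section \<open>The derivative along the linear vector field \<open>(y, 0, - lam z)\<close>\<close>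

definition lin_deriv :: "real \<Rightarrow> fps3 \<Rightarrow> fps3" where
  "lin_deriv lam F = fps3_var 2 * fps3_pderiv 1 F - fps3_const lam * (fps3_var 3 * fps3_pderiv 3 F)"

lemma lin_deriv_diff: "lin_deriv lam (F - G) = lin_deriv lam F - lin_deriv lam G"
  by (simp add: lin_deriv_def fps3_pderiv_diff algebra_simps)

lemma lin_deriv_add: "lin_deriv lam (F + G) = lin_deriv lam F + lin_deriv lam G"
  by (simp add: lin_deriv_def fps3_pderiv_add algebra_simps)

lemma order_ge_lin_deriv: "order_ge n F \<Longrightarrow> order_ge n (lin_deriv lam F)"
  by (simp add: lin_deriv_def order_ge_diff order_ge_var_mult_pderiv order_ge_const_mult)

lemma lin_deriv_of_fps: "lin_deriv lam (fps3_of_fps A) = fps3_var 2 * fps3_of_fps (fps_deriv A)"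
  by (simp add: lin_deriv_def fps3_pderiv_of_fps)

text \<open>\<open>z \<partial>\<^sub>z\<close> is an Euler operator, diagonal with eigenvalue
  \<open>k\<close>. Hence \<open>lin_deriv\<close> has the form
  \<open>y \<partial>\<^sub>x + \<mu>\<^sub>k\<close> that \<open>solve\<close> handles.\<close>

lemma fps3_coeff_lin_deriv:
  "fps3_coeff (lin_deriv lam F) i j k
    = fps3_coeff (fps3_var 2 * fps3_pderiv 1 F) i j k - lam * real k * fps3_coeff F i j k"
proof (cases k)
  case (Suc k')
  then show ?thesis by (simp add: lin_deriv_def fps3_var_eq fps3_const_def fps3_coeff_pderiv)
qed (simp add: lin_deriv_def fps3_var_eq fps3_const_def)

text \<open>As \<open>lam \<noteq> 0\<close>, \<open>\<mu>\<^sub>k = - lam k\<close> vanishes only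
  at \<open>k = 0\<close>, so exactly the terms in \<open>x\<close> alone remain.\<close>

lemma lin_deriv_solve:
  assumes "lam \<noteq> 0"
  shows "lin_deriv lam (solve (\<lambda>k. - lam * real k) H)
    = H - fps3_of_fps (Abs_fps (\<lambda>i. fps3_coeff H i 0 0))"
proof (rule fps3_eqI)
  fix i j k
  show "fps3_coeff (lin_deriv lam (solve (\<lambda>k. - lam * real k) H)) i j k
    = fps3_coeff (H - fps3_of_fps (Abs_fps (\<lambda>i. fps3_coeff H i 0 0))) i j k"
    using solve_coeff_equation[of "\<lambda>k. - lam * real k" H i j k] assms
    by (auto simp: fps3_coeff_lin_deriv fps3_coeff_of_fps)
qed

lemma fps3_coeff_var3_mult_of_fps:
  "fps3_coeff (fps3_var 3 * fps3_of_fps A) i j k = (if j = 0 \<and> k = 1 then fps_nth A i else 0)"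
  by (cases k) (auto simp: fps3_var_eq fps3_coeff_of_fps)

text \<open>The eigenvalue of the third equation shifts the resonance: \<open>lam (1 - k)\<close>
  vanishes only at \<open>k = 1\<close>, which leaves \<open>z\<close> times a series in
  \<open>x\<close>.\<close>

lemma lin_deriv_solve_resonant:
  assumes "lam \<noteq> 0"
  shows "lin_deriv lam (solve (\<lambda>k. lam * (1 - real k)) H)
      + fps3_const lam * solve (\<lambda>k. lam * (1 - real k)) H
    = H - fps3_var 3 * fps3_of_fps (Abs_fps (\<lambda>i. fps3_coeff H i 0 1))"
proof (rule fps3_eqI)
  fix i j k
  show "fps3_coeff (lin_deriv lam (solve (\<lambda>k. lam * (1 - real k)) H)
      + fps3_const lam * solve (\<lambda>k. lam * (1 - real k)) H) i j k
    = fps3_coeff (H - fps3_var 3 * fps3_of_fps (Abs_fps (\<lambda>i. fps3_coeff H i 0 1))) i j k"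
    using solve_coeff_equation[of "\<lambda>k. lam * (1 - real k)" H i j k] assms
    by (auto simp: fps3_coeff_lin_deriv fps3_coeff_var3_mult_of_fps fps3_const_def algebra_simps
        simp del: One_nat_def split: if_splits)
qed

text \<open>The operator \<open>L \<phi> = D\<phi> A - A \<phi>\<close> for
  \<open>A = (y, 0, - lam z)\<close>; the term \<open>- \<phi> $ 2\<close> comes from the nilpotent
  block in \<open>x\<close> and \<open>y\<close>.\<close>

definition homological_op :: "real \<Rightarrow> fps3^3 \<Rightarrow> fps3^3" where
  "homological_op lam \<phi> = vector
    [lin_deriv lam (\<phi> $ 1) - \<phi> $ 2, lin_deriv lam (\<phi> $ 2), lin_deriv lam (\<phi> $ 3) + fps3_const lam * \<phi> $ 3]"

text \<open>
  The series \<open>x_correction\<close> in \<open>x\<close> alone moves the terms of the first equation that cannot be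
  removed into the shape \<open>x P\<^sub>1(x)\<close>, with the same \<open>P\<^sub>1\<close> as in the second equation.
\<close>

definition x_correction :: "real \<Rightarrow> fps3^3 \<Rightarrow> real fps" where
  "x_correction lam H = Abs_fps (\<lambda>i.
    - fps3_coeff (H $ 1 + solve (\<lambda>k. - lam * real k) (H $ 2)) i 0 0 / real (Suc i))"

text \<open>The map \<sigma>. The second component \<open>S\<close> comes first, since it enters the
  first equation. There \<open>x C'\<close> stands for \<open>- x P\<^sub>1\<close>, and
  \<open>C\<close> cancels the terms in \<open>x\<close> alone, which \<open>solve\<close> cannot
  reach.\<close>

definition homological_sol :: "real \<Rightarrow> fps3^3 \<Rightarrow> fps3^3" where
  "homological_sol lam H =
    (let C = fps3_of_fps (x_correction lam H);
         S = solve (\<lambda>k. - lam * real k) (H $ 2) + C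
     in vector [solve (\<lambda>k. - lam * real k) (H $ 1 + S + fps3_var 1 * fps3_pderiv 1 C), S,
          solve (\<lambda>k. lam * (1 - real k)) (H $ 3)])"

text \<open>The map \<gamma>, defined as a residue: the splitting of \<open>H\<close> is then
  immediate, and the work lies in showing that the residue is in normal form.\<close>

definition normal_part :: "real \<Rightarrow> fps3^3 \<Rightarrow> fps3^3" where
  "normal_part lam H = H - homological_op lam (homological_sol lam H)"

lemma fps3_of_fps_diff: "fps3_of_fps (A - B) = fps3_of_fps A - fps3_of_fps B"
  by (auto intro!: fps3_eqI simp: fps3_coeff_of_fps)

lemma x_correction_diff: "x_correction lam (H - K) = x_correction lam H - x_correction lam K"
  by (rule fps_ext) (simp add: x_correction_def solve_coeff_diff diff_divide_distrib add_divide_distrib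
      del: solve_coeff.simps)

lemma order_ge_x_correction:
  assumes "vec_order_ge n H" shows "order_ge n (fps3_of_fps (x_correction lam H))"
proof -
  have "order_ge n (H $ 1 + solve (\<lambda>k. - lam * real k) (H $ 2))"
    using assms by (intro order_ge_add order_ge_solve vec_order_geD)
  then show ?thesis
    by (auto simp: order_ge_iff fps3_coeff_of_fps x_correction_def simp del: fps_add_nth)
qed

text \<open>Lets the order bound for \<open>homological_sol\<close> be applied to differences in the
  contraction estimate.\<close>

lemma homological_sol_diff: "homological_sol lam (H - K) = homological_sol lam H - homological_sol lam K"
proof -
  define C where "C H = fps3_of_fps (x_correction lam H)" for H
  define S where "S H = solve (\<lambda>k. - lam * real k) (H $ 2) + C H" for H
  define E where "E H = H $ 1 + S H + fps3_var 1 * fps3_pderiv 1 (C H)" for H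
  have sol: "homological_sol lam H
      = vector [solve (\<lambda>k. - lam * real k) (E H), S H, solve (\<lambda>k. lam * (1 - real k)) (H $ 3)]" for H
    by (simp add: homological_sol_def Let_def C_def S_def E_def)
  have C: "C (H - K) = C H - C K"
    by (simp add: C_def x_correction_diff fps3_of_fps_diff)
  have S: "S (H - K) = S H - S K"
    by (simp add: S_def C solve_diff)
  have "E (H - K) = E H - E K"
    by (simp add: E_def S C fps3_pderiv_diff algebra_simps)
  with S show ?thesis
    by (simp add: sol solve_diff vec_eq_iff forall_3)
qed

lemma vec_order_ge_homological_sol:
  "vec_order_ge n H \<Longrightarrow> vec_order_ge n (homological_sol lam H)"
  unfolding vec_order_ge_def[of n "homological_sol lam H"]
  by (simp add: homological_sol_def Let_def forall_3 order_ge_add order_ge_solve order_ge_x_correction order_ge_var_mult_pderiv vec_order_geD)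

lemma homological_op_diff: "homological_op lam (\<phi> - \<psi>) = homological_op lam \<phi> - homological_op lam \<psi>"
  by (simp add: homological_op_def vec_eq_iff forall_3 lin_deriv_diff algebra_simps)

lemma vec_order_ge_homological_op:
  "vec_order_ge n \<phi> \<Longrightarrow> vec_order_ge n (homological_op lam \<phi>)"
  by (simp add: vec_order_ge_def homological_op_def forall_3 order_ge_add order_ge_diff
      order_ge_lin_deriv order_ge_const_mult)

lemma normal_part_diff: "normal_part lam (H - K) = normal_part lam H - normal_part lam K"
  by (simp add: normal_part_def homological_sol_diff homological_op_diff)

lemma vec_order_ge_normal_part: "vec_order_ge n H \<Longrightarrow> vec_order_ge n (normal_part lam H)"
  by (simp add: normal_part_def vec_order_ge_diff vec_order_ge_homological_op vec_order_ge_homological_sol)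

text \<open>One series \<open>C\<close> produces both occurrences of
  \<open>P\<^sub>1 = - C'\<close>: it enters the first equation through \<open>x C'\<close>, and the
  second because \<open>lin_deriv\<close> maps it to \<open>y C'\<close>.\<close>

lemma normal_part_eq:
  assumes "lam \<noteq> 0"
  defines "P\<^sub>1 \<equiv> \<lambda>H. - fps_deriv (x_correction lam H)"
  shows "normal_part lam H = vector
    [fps3_var 1 * fps3_of_fps (P\<^sub>1 H),
     fps3_of_fps (Abs_fps (\<lambda>i. fps3_coeff (H $ 2) i 0 0)) + fps3_var 2 * fps3_of_fps (P\<^sub>1 H),
     fps3_var 3 * fps3_of_fps (Abs_fps (\<lambda>i. fps3_coeff (H $ 3) i 0 1))]"
proof -
  define C where "C = fps3_of_fps (x_correction lam H)"
  define S where "S = solve (\<lambda>k. - lam * real k) (H $ 2) + C"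
  define E where "E = H $ 1 + S + fps3_var 1 * fps3_pderiv 1 C"
  \<comment> \<open>\<open>C\<close> enters \<open>E\<close> once through \<open>S\<close> and
    \<open>i\<close> times through \<open>x \<partial>\<^sub>x C\<close>, which explains the divisor
    \<open>Suc i\<close> in \<open>x_correction\<close>.\<close>
  have "fps3_coeff E i 0 0 = 0" for i
  proof -
    define u where "u = fps3_coeff (H $ 1 + solve (\<lambda>k. - lam * real k) (H $ 2)) i 0 0"
    have C: "fps3_coeff C i 0 0 = - u / real (Suc i)"
      by (simp only: C_def fps3_coeff_of_fps x_correction_def u_def fps_nth_Abs_fps if_True simp_thms)
    have "fps3_coeff (fps3_var 1 * fps3_pderiv 1 C) i 0 0 = real i * fps3_coeff C i 0 0"
      by (cases i) (simp_all add: fps3_var_eq fps3_coeff_pderiv)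
    then have "fps3_coeff E i 0 0 = u + real (Suc i) * fps3_coeff C i 0 0"
      by (simp add: E_def S_def u_def algebra_simps del: solve_coeff.simps)
    then show ?thesis by (simp add: C del: of_nat_Suc)
  qed
  then have E: "fps3_of_fps (Abs_fps (\<lambda>i. fps3_coeff E i 0 0)) = 0"
    by (auto intro!: fps3_eqI simp: fps3_coeff_of_fps)
  have sol: "homological_sol lam H
      = vector [solve (\<lambda>k. - lam * real k) E, S, solve (\<lambda>k. lam * (1 - real k)) (H $ 3)]"
    by (simp add: homological_sol_def Let_def C_def S_def E_def)
  have "lin_deriv lam C = - (fps3_var 2 * fps3_of_fps (P\<^sub>1 H))"
    by (simp add: C_def P\<^sub>1_def lin_deriv_of_fps fps3_of_fps_uminus)
  then have S: "lin_deriv lam S = H $ 2 - fps3_of_fps (Abs_fps (\<lambda>i. fps3_coeff (H $ 2) i 0 0))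
      - fps3_var 2 * fps3_of_fps (P\<^sub>1 H)"
    unfolding S_def lin_deriv_add lin_deriv_solve[OF assms(1)] by simp
  have "fps3_var 1 * fps3_pderiv 1 C = - (fps3_var 1 * fps3_of_fps (P\<^sub>1 H))"
    by (simp add: C_def P\<^sub>1_def fps3_pderiv_of_fps fps3_of_fps_uminus)
  then have "lin_deriv lam (solve (\<lambda>k. - lam * real k) E) = H $ 1 + S - fps3_var 1 * fps3_of_fps (P\<^sub>1 H)"
    by (simp only: lin_deriv_solve[OF assms(1)] E) (simp add: E_def)
  then show ?thesis
    by (simp add: normal_part_def homological_op_def sol S lin_deriv_solve_resonant[OF assms(1)]
        vec_eq_iff forall_3)
qed


section \<open>The normal form\<close>

text \<open>Differentiation costs one order; for \<open>n = 0\<close> the truncated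
  \<open>n - 1\<close> is harmless, as every series has order 0.\<close>

lemma vec_order_ge_jacobian_mult:
  assumes "vec_order_ge n \<phi>" "vec_order_ge n' G"
  shows "vec_order_ge (n - 1 + n') (formal_jacobian \<phi> *v G)"
proof -
  have "order_ge (n - 1) (fps3_pderiv j (\<phi> $ i))" for i j
    using vec_order_geD[OF assms(1), of i] by (cases n) (auto intro: order_ge_pderiv)
  then show ?thesis
    using assms(2)
    by (auto simp: vec_order_ge_def formal_jacobian_def matrix_vector_mult_def
        intro!: order_ge_sum order_ge_mult)
qed

lemma formal_jacobian_add: "formal_jacobian (\<phi> + \<psi>) = formal_jacobian \<phi> + formal_jacobian \<psi>"
  by (simp add: formal_jacobian_def vec_eq_iff fps3_pderiv_add)

lemma formal_jacobian_diff: "formal_jacobian (\<phi> - \<psi>) = formal_jacobian \<phi> - formal_jacobian \<psi>"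
  by (simp add: formal_jacobian_def vec_eq_iff fps3_pderiv_diff)

lemma formal_jacobian_id: "formal_jacobian formal_id = mat 1"
  by (simp add: formal_jacobian_def formal_id_def mat_def vec_eq_iff fps3_pderiv_var)

lemma conjugacy_fixpoint:
  assumes "vec_order_ge 2 f"
  obtains H where "vec_order_ge 2 H"
    "formal_comp f (formal_id + homological_sol lam H)
      - formal_jacobian (homological_sol lam H) *v normal_part lam H = H"
proof (rule contraction_fixpoint[of "\<lambda>H. formal_comp f (formal_id + homological_sol lam H)
      - formal_jacobian (homological_sol lam H) *v normal_part lam H"])
  let ?\<sigma> = "homological_sol lam" and ?\<gamma> = "normal_part lam"
  show "vec_order_ge 2 (formal_comp f (formal_id + ?\<sigma> H) - formal_jacobian (?\<sigma> H) *v ?\<gamma> H)"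
    if H: "vec_order_ge 2 H" for H
  proof (rule vec_order_ge_diff)
    show "vec_order_ge 2 (formal_comp f (formal_id + ?\<sigma> H))"
      by (intro vec_order_ge_comp assms formal_fixes_origin_near_id vec_order_ge_homological_sol H)
    show "vec_order_ge 2 (formal_jacobian (?\<sigma> H) *v ?\<gamma> H)"
      by (rule vec_order_ge_mono[OF vec_order_ge_jacobian_mult
            [OF vec_order_ge_homological_sol[OF H] vec_order_ge_normal_part[OF H]]]) simp
  qed
  fix n H K assume H: "vec_order_ge 2 H" and K: "vec_order_ge 2 K" and HK: "vec_order_ge n (H - K)"
  have \<sigma>: "vec_order_ge n (?\<sigma> H - ?\<sigma> K)"
    unfolding homological_sol_diff[symmetric] by (rule vec_order_ge_homological_sol[OF HK])
  have \<gamma>: "vec_order_ge n (?\<gamma> H - ?\<gamma> K)"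
    unfolding normal_part_diff[symmetric] by (rule vec_order_ge_normal_part[OF HK])
  \<comment> \<open>The difference of the bilinear terms is split by the product rule; in each part
    the factor of order 2 outweighs the loss of one order by the Jacobian.\<close>
  have "vec_order_ge (Suc n) (formal_jacobian (?\<sigma> H) *v (?\<gamma> H - ?\<gamma> K))"
    by (rule vec_order_ge_mono[OF vec_order_ge_jacobian_mult[OF vec_order_ge_homological_sol[OF H] \<gamma>]]) simp
  moreover have "vec_order_ge (Suc n) (formal_jacobian (?\<sigma> H - ?\<sigma> K) *v ?\<gamma> K)"
    by (rule vec_order_ge_mono[OF vec_order_ge_jacobian_mult[OF \<sigma> vec_order_ge_normal_part[OF K]]]) simp
  ultimately have "vec_order_ge (Suc n) (formal_jacobian (?\<sigma> H) *v ?\<gamma> H - formal_jacobian (?\<sigma> K) *v ?\<gamma> K)"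
    using vec_order_ge_add
    by (fastforce simp: formal_jacobian_diff matrix_vector_mult_diff_distrib matrix_vector_mult_diff_rdistrib)
  moreover have "vec_order_ge (Suc n) (formal_comp f (formal_id + ?\<sigma> H) - formal_comp f (formal_id + ?\<sigma> K))"
    by (intro vec_order_ge_comp_diff assms vec_order_ge_homological_sol H K \<sigma>)
  ultimately show "vec_order_ge (Suc n)
      (formal_comp f (formal_id + ?\<sigma> H) - formal_jacobian (?\<sigma> H) *v ?\<gamma> H
       - (formal_comp f (formal_id + ?\<sigma> K) - formal_jacobian (?\<sigma> K) *v ?\<gamma> K))"
    using vec_order_ge_diff by (fastforce simp: algebra_simps)
qed (use that in blast)

text \<open>Both sides of the chain rule are expanded around \<open>A\<close>; after cancelling
  \<open>A\<close>, \<open>eq\<close> is what remains.\<close>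

lemma formally_transforms_near_linear:
  assumes "vec_order_ge 2 \<phi>"
    and eq: "homological_op lam \<phi> + g = formal_comp f (formal_id + \<phi>) - formal_jacobian \<phi> *v g"
  defines "A \<equiv> vector [fps3_var 2, 0, - fps3_const lam * fps3_var 3]"
  shows "formally_transforms (formal_id + \<phi>) (A + f) (A + g)"
proof -
  note \<Phi> = formal_fixes_origin_near_id[OF assms(1)]
  have jac: "formal_jacobian \<phi> *v A = (\<chi> i. lin_deriv lam (\<phi> $ i))"
    by (simp add: vec_eq_iff formal_jacobian_def matrix_vector_mult_def sum_3 A_def lin_deriv_def
        algebra_simps)
  have zero: "fps3_compose 0 \<Phi> = 0" for \<Phi>
    by (simp add: fps3_compose_def fps3_eq_iff)
  \<comment> \<open>\<open>A\<close> is linear, so the added vector is \<open>A \<phi>\<close>, that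
    is \<open>D\<phi> A - L \<phi>\<close>.\<close>
  have "formal_comp A (formal_id + \<phi>) = A + vector [\<phi> $ 2, 0, - fps3_const lam * \<phi> $ 3]"
    by (simp add: formal_comp_def A_def vec_eq_iff forall_3 fps3_compose_var[OF \<Phi>] fps3_compose_uminus
        fps3_compose_const_mult zero formal_id_nth algebra_simps)
  also have "\<dots> = A + (formal_jacobian \<phi> *v A - homological_op lam \<phi>)"
    by (simp add: jac homological_op_def vec_eq_iff forall_3)
  finally have "formal_comp (A + f) (formal_id + \<phi>)
      = A + formal_jacobian \<phi> *v A - homological_op lam \<phi> + formal_comp f (formal_id + \<phi>)"
    by (simp add: formal_comp_add)
  also have "formal_comp f (formal_id + \<phi>) = homological_op lam \<phi> + g + formal_jacobian \<phi> *v g"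
    by (simp add: eq)
  finally show ?thesis
    by (simp add: formally_transforms_def formal_jacobian_add formal_jacobian_id
        matrix_vector_mult_add_rdistrib matrix_vector_right_distrib algebra_simps)
qed

theorem theorem25:
  fixes lam :: real and P Q R :: "real^3 \<Rightarrow> real"
  assumes "lam \<noteq> 0"
    and "real_analytic_at_0 P" and "real_analytic_at_0 Q" and "real_analytic_at_0 R"
    and "fps3_jet 1 (taylor_series P) = 0"
    and "fps3_jet 1 (taylor_series Q) = 0"
    and "fps3_jet 1 (taylor_series R) = 0"
  shows "\<exists>\<Phi> P\<^sub>1 Q\<^sub>2 R\<^sub>1.
    formal_change_of_variables \<Phi> \<and>
    fps_nth P\<^sub>1 0 = 0 \<and> fps_cutoff 2 Q\<^sub>2 = 0 \<and> fps_nth R\<^sub>1 0 = 0 \<and>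
    (let X = fps3_var 1; Y = fps3_var 2; Z = fps3_var 3 in
     formally_transforms \<Phi>
       (vector [Y + taylor_series P,
                taylor_series Q,
                - fps3_const lam * Z + taylor_series R])
       (vector [Y + X * fps3_of_fps P\<^sub>1,
                fps3_of_fps Q\<^sub>2 + Y * fps3_of_fps P\<^sub>1,
                - fps3_const lam * Z + Z * fps3_of_fps R\<^sub>1]))"
proof -
  define f where "f = (vector [taylor_series P, taylor_series Q, taylor_series R] :: fps3^3)"
  have "vec_order_ge 2 f"
    using assms by (simp add: vec_order_ge_def forall_3 f_def numeral_2_eq_2 order_ge_Suc_iff_fps3_jet)
  then obtain H where H: "vec_order_ge 2 H"
    "formal_comp f (formal_id + homological_sol lam H)
      - formal_jacobian (homological_sol lam H) *v normal_part lam H = H"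
    by (rule conjugacy_fixpoint)
  define \<phi> where "\<phi> = homological_sol lam H"
  define P\<^sub>1 where "P\<^sub>1 = - fps_deriv (x_correction lam H)"
  define Q\<^sub>2 where "Q\<^sub>2 = Abs_fps (\<lambda>i. fps3_coeff (H $ 2) i 0 0)"
  define R\<^sub>1 where "R\<^sub>1 = Abs_fps (\<lambda>i. fps3_coeff (H $ 3) i 0 1)"
  have \<phi>: "vec_order_ge 2 \<phi>"
    unfolding \<phi>_def by (rule vec_order_ge_homological_sol[OF H(1)])
  have H_coeff: "fps3_coeff (H $ l) i j k = 0" if "i + j + k < 2" for l i j k
    using H(1) that by (simp add: vec_order_ge_def order_ge_iff)
  \<comment> \<open>With this splitting, the fixed point equation for \<open>H\<close> becomes the
    conjugacy equation for \<phi>.\<close>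
  have "homological_op lam \<phi> + normal_part lam H = H"
    by (simp add: normal_part_def \<phi>_def)
  then have "formally_transforms (formal_id + \<phi>)
    (vector [fps3_var 2, 0, - fps3_const lam * fps3_var 3] + f)
    (vector [fps3_var 2, 0, - fps3_const lam * fps3_var 3] + normal_part lam H)"
    by (intro formally_transforms_near_linear[OF \<phi>]) (simp add: \<phi>_def H(2))
  moreover have "vector [fps3_var 2, 0, - fps3_const lam * fps3_var 3] + f
    = vector [fps3_var 2 + taylor_series P, taylor_series Q, - fps3_const lam * fps3_var 3 + taylor_series R]"
    by (simp add: f_def vec_eq_iff forall_3)
  moreover have "vector [fps3_var 2, 0, - fps3_const lam * fps3_var 3] + normal_part lam H
    = vector [fps3_var 2 + fps3_var 1 * fps3_of_fps P\<^sub>1, fps3_of_fps Q\<^sub>2 + fps3_var 2 * fps3_of_fps P\<^sub>1,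
        - fps3_const lam * fps3_var 3 + fps3_var 3 * fps3_of_fps R\<^sub>1]"
    by (simp add: normal_part_eq[OF assms(1)] P\<^sub>1_def Q\<^sub>2_def R\<^sub>1_def vec_eq_iff forall_3)
  \<comment> \<open>Up to sign this is the coefficient of \<open>x\<close> in the correction series,
    which has order 2 like \<open>H\<close>.\<close>
  moreover have "fps_nth P\<^sub>1 0 = 0"
    using order_geD[OF order_ge_x_correction[OF H(1), of lam], of "vector [1, 0, 0]"]
    by (simp add: P\<^sub>1_def fps3_coeff_of_fps)
  moreover have "fps_cutoff 2 Q\<^sub>2 = 0"
    by (rule fps_ext) (simp add: Q\<^sub>2_def H_coeff)
  \<comment> \<open>This is the coefficient of \<open>z\<close> in \<open>H $ 3\<close>, of degree
    1.\<close>
  moreover have "fps_nth R\<^sub>1 0 = 0"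
    by (simp add: R\<^sub>1_def H_coeff)
  ultimately show ?thesis
    unfolding Let_def using formal_change_of_variables_near_id[OF \<phi>] by metis
qed

end
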